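(* Let $\lambda$ be an infinite cardinal and let $D$ be a $\lambda$-regular ultrafilter on $\lambda$. If $M$ is a model of any unstable first-order theory, then $M^\lambda/D$ is not $(2^\lambda)^+$-saturated.
   Context: All languages are countable, and theories are complete. An ultrafilter $D$ on $\lambda$ is $\lambda$-regular if there are $X_i \in D$ ($i<\lambda$) such that each $t\in \lambda$ belongs to only finitely many $X_i$. A theory $T$ is unstable if some formula $\varphi(x;y)$ ($x,y$ possibly tuples) has the order property: in a sufficiently saturated model there are $a_i$ ($i<\omega$) such that for each $n<\omega$ the set $\{\neg\varphi(x;a_i): i<n\}\cup\{\varphi(x;a_j): j\geq n\}$ is consistent. *)

theory Defs
  imports
    Main
    "HOL-Library.FuncSet"
    "HOL-Library.Countable_Set"
begin

unbundle cardinal_syntax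

section \<open>First-order logic\<close>

record ('f, 'r) language =
  funs :: "'f set"
  rels :: "'r set"
  fun_arity :: "'f \<Rightarrow> nat"
  rel_arity :: "'r \<Rightarrow> nat"

definition countable_language :: "('f, 'r) language \<Rightarrow> bool" where
  "countable_language L \<longleftrightarrow> countable (funs L) \<and> countable (rels L)"

datatype 'f fo_term = Var nat | Fun 'f "'f fo_term list"

datatype ('f, 'r) fo_formula =
    Eq "'f fo_term" "'f fo_term"
  | Rel 'r "'f fo_term list"
  | Neg "('f, 'r) fo_formula"
  | Conj "('f, 'r) fo_formula" "('f, 'r) fo_formula"
  | Exists nat "('f, 'r) fo_formula"

fun term_vars :: "'f fo_term \<Rightarrow> nat set" where
  "term_vars (Var n) = {n}"
| "term_vars (Fun f ts) = (\<Union>t\<in>set ts. term_vars t)"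

primrec free_vars :: "('f, 'r) fo_formula \<Rightarrow> nat set" where
  "free_vars (Eq s t) = term_vars s \<union> term_vars t"
| "free_vars (Rel r ts) = (\<Union>t\<in>set ts. term_vars t)"
| "free_vars (Neg \<phi>) = free_vars \<phi>"
| "free_vars (Conj \<phi> \<psi>) = free_vars \<phi> \<union> free_vars \<psi>"
| "free_vars (Exists n \<phi>) = free_vars \<phi> - {n}"

fun is_term :: "('f, 'r) language \<Rightarrow> 'f fo_term \<Rightarrow> bool" where
  "is_term L (Var n) \<longleftrightarrow> True"
| "is_term L (Fun f ts) \<longleftrightarrow>
     f \<in> funs L \<and> length ts = fun_arity L f \<and> (\<forall>t\<in>set ts. is_term L t)"

primrec is_formula :: "('f, 'r) language \<Rightarrow> ('f, 'r) fo_formula \<Rightarrow> bool" where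
  "is_formula L (Eq s t) \<longleftrightarrow> is_term L s \<and> is_term L t"
| "is_formula L (Rel r ts) \<longleftrightarrow>
     r \<in> rels L \<and> length ts = rel_arity L r \<and> (\<forall>t\<in>set ts. is_term L t)"
| "is_formula L (Neg \<phi>) \<longleftrightarrow> is_formula L \<phi>"
| "is_formula L (Conj \<phi> \<psi>) \<longleftrightarrow> is_formula L \<phi> \<and> is_formula L \<psi>"
| "is_formula L (Exists n \<phi>) \<longleftrightarrow> is_formula L \<phi>"

definition is_sentence :: "('f, 'r) language \<Rightarrow> ('f, 'r) fo_formula \<Rightarrow> bool" where
  "is_sentence L \<phi> \<longleftrightarrow> is_formula L \<phi> \<and> free_vars \<phi> = {}"

record ('f, 'r, 'a) fo_structure =
  univ :: "'a set"
  fun_interp :: "'f \<Rightarrow> 'a list \<Rightarrow> 'a"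
  rel_interp :: "'r \<Rightarrow> 'a list \<Rightarrow> bool"

definition is_structure :: "('f, 'r) language \<Rightarrow> ('f, 'r, 'a) fo_structure \<Rightarrow> bool" where
  "is_structure L M \<longleftrightarrow> univ M \<noteq> {} \<and>
     (\<forall>f\<in>funs L. \<forall>xs. length xs = fun_arity L f \<longrightarrow> set xs \<subseteq> univ M \<longrightarrow>
        fun_interp M f xs \<in> univ M)"

primrec eval_term :: "('f, 'r, 'a) fo_structure \<Rightarrow> (nat \<Rightarrow> 'a) \<Rightarrow> 'f fo_term \<Rightarrow> 'a" where
  "eval_term M e (Var n) = e n"
| "eval_term M e (Fun f ts) = fun_interp M f (map (eval_term M e) ts)"

primrec sat :: "('f, 'r, 'a) fo_structure \<Rightarrow> (nat \<Rightarrow> 'a) \<Rightarrow> ('f, 'r) fo_formula \<Rightarrow> bool" where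
  "sat M e (Eq s t) \<longleftrightarrow> eval_term M e s = eval_term M e t"
| "sat M e (Rel r ts) \<longleftrightarrow> rel_interp M r (map (eval_term M e) ts)"
| "sat M e (Neg \<phi>) \<longleftrightarrow> \<not> sat M e \<phi>"
| "sat M e (Conj \<phi> \<psi>) \<longleftrightarrow> sat M e \<phi> \<and> sat M e \<psi>"
| "sat M e (Exists n \<phi>) \<longleftrightarrow> (\<exists>a\<in>univ M. sat M (e(n := a)) \<phi>)"

definition is_model ::
  "('f, 'r) language \<Rightarrow> ('f, 'r, 'a) fo_structure \<Rightarrow> ('f, 'r) fo_formula set \<Rightarrow> bool" where
  "is_model L M T \<longleftrightarrow> is_structure L M \<and>
     (\<forall>\<sigma>\<in>T. \<forall>e. range e \<subseteq> univ M \<longrightarrow> sat M e \<sigma>)"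

text \<open>
  A theory is identified with the set of its consequences, so completeness means that \<open>T\<close>
  contains every sentence or its negation. Consistency is not part of this definition; it holds
  as soon as \<open>T\<close> has a model.
\<close>

definition complete_theory :: "('f, 'r) language \<Rightarrow> ('f, 'r) fo_formula set \<Rightarrow> bool" where
  "complete_theory L T \<longleftrightarrow> (\<forall>\<sigma>\<in>T. is_sentence L \<sigma>) \<and>
     (\<forall>\<sigma>. is_sentence L \<sigma> \<longrightarrow> \<sigma> \<in> T \<or> Neg \<sigma> \<in> T)"

section \<open>Types and saturation\<close>

text \<open>
  A formula with parameters is a pair \<open>(\<phi>, e)\<close>. Relative to a set \<open>X\<close> of variables, the free
  variables of \<open>\<phi>\<close> in \<open>X\<close> are the object variables, and every other free variable \<open>v\<close> stands
  for the parameter \<open>e v\<close>. A tuple of elements for the object variables is given by the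
  restriction of some \<open>b\<close> to \<open>X\<close>.
\<close>

definition formulas_over ::
  "('f, 'r) language \<Rightarrow> nat set \<Rightarrow> 'a set \<Rightarrow> (('f, 'r) fo_formula \<times> (nat \<Rightarrow> 'a)) set" where
  "formulas_over L X A = {(\<phi>, e). is_formula L \<phi> \<and> e ` (free_vars \<phi> - X) \<subseteq> A}"

definition realized ::
  "('f, 'r, 'a) fo_structure \<Rightarrow> nat set \<Rightarrow> (('f, 'r) fo_formula \<times> (nat \<Rightarrow> 'a)) set \<Rightarrow> bool" where
  "realized M X p \<longleftrightarrow>
     (\<exists>b. b ` X \<subseteq> univ M \<and> (\<forall>(\<phi>, e)\<in>p. sat M (override_on e b X) \<phi>))"

text \<open>
  By compactness, a set of formulas with parameters in \<open>M\<close> is consistent with the elementary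
  diagram of \<open>M\<close> iff it is finitely satisfiable in \<open>M\<close>.
\<close>

definition consistent_in ::
  "('f, 'r, 'a) fo_structure \<Rightarrow> nat set \<Rightarrow> (('f, 'r) fo_formula \<times> (nat \<Rightarrow> 'a)) set \<Rightarrow> bool" where
  "consistent_in M X p \<longleftrightarrow> (\<forall>q\<subseteq>p. finite q \<longrightarrow> realized M X q)"

text \<open>
  \<open>\<kappa>\<close>-saturation in terms of types in a single variable (here variable \<open>0\<close>). Types need not be
  complete.
\<close>

definition saturated :: "'k rel \<Rightarrow> ('f, 'r) language \<Rightarrow> ('f, 'r, 'a) fo_structure \<Rightarrow> bool" where
  "saturated \<kappa> L M \<longleftrightarrow>
     (\<forall>A\<subseteq>univ M. |A| <o \<kappa> \<longrightarrow>
        (\<forall>p\<subseteq>formulas_over L {0} A. consistent_in M {0} p \<longrightarrow> realized M {0} p))"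

section \<open>Unstable theories\<close>

text \<open>
  The order property for \<open>\<phi>(x; y)\<close>, where \<open>X\<close> is the set of variables in the tuple \<open>x\<close> and the
  other free variables of \<open>\<phi>\<close> form \<open>y\<close>; the values of \<open>a i\<close> at the latter are the tuple \<open>a\<^sub>i\<close>.
\<close>

definition order_property ::
  "('f, 'r, 'a) fo_structure \<Rightarrow> ('f, 'r) fo_formula \<Rightarrow> nat set \<Rightarrow> bool" where
  "order_property N \<phi> X \<longleftrightarrow>
     (\<exists>a :: nat \<Rightarrow> nat \<Rightarrow> 'a. (\<forall>i. range (a i) \<subseteq> univ N) \<and>
        (\<forall>n. consistent_in N X ({(Neg \<phi>, a i) | i. i < n} \<union> {(\<phi>, a j) | j. n \<le> j})))"

text \<open>
  HOL cannot quantify over types inside a formula, so the type \<open>'u\<close> of the elements of the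
  sufficiently saturated model is an argument. Since this predicate is used as a hypothesis with
  \<open>'u\<close> a type variable, i.e. for arbitrary \<open>'u\<close>, no bound is put on the size of that model. The
  order property concerns countably many parameters, so \<open>\<aleph>\<^sub>1\<close>-saturation is sufficient.
\<close>

definition unstable ::
  "'u itself \<Rightarrow> ('f, 'r) language \<Rightarrow> ('f, 'r) fo_formula set \<Rightarrow> bool" where
  "unstable _ L T \<longleftrightarrow>
     (\<exists>(N :: ('f, 'r, 'u) fo_structure) \<phi> X.
        is_model L N T \<and> saturated (cardSuc natLeq) L N \<and>
        is_formula L \<phi> \<and> finite X \<and> order_property N \<phi> X)"

section \<open>Ultrafilters and ultrapowers\<close>

definition ultrafilter_on :: "'i set \<Rightarrow> 'i set set \<Rightarrow> bool" where
  "ultrafilter_on I D \<longleftrightarrow> D \<subseteq> Pow I \<and> I \<in> D \<and> {} \<notin> D \<and>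
     (\<forall>X\<in>D. \<forall>Y\<in>D. X \<inter> Y \<in> D) \<and>
     (\<forall>X\<in>D. \<forall>Y. X \<subseteq> Y \<and> Y \<subseteq> I \<longrightarrow> Y \<in> D) \<and>
     (\<forall>X\<subseteq>I. X \<in> D \<or> I - X \<in> D)"

text \<open>
  A cardinal \<open>lam\<close> is a cardinal order; as a set it is \<open>Field lam\<close>. The regularizing family is
  indexed, so sets occurring at several indices are counted with multiplicity.
\<close>

definition regular_ultrafilter :: "'i rel \<Rightarrow> 'i set set \<Rightarrow> bool" where
  "regular_ultrafilter lam D \<longleftrightarrow> ultrafilter_on (Field lam) D \<and>
     (\<exists>X :: 'i \<Rightarrow> 'i set. (\<forall>i\<in>Field lam. X i \<in> D) \<and>
        (\<forall>t\<in>Field lam. finite {i \<in> Field lam. t \<in> X i}))"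

definition ultra_rel ::
  "'i set \<Rightarrow> 'i set set \<Rightarrow> ('f, 'r, 'a) fo_structure \<Rightarrow> ('i \<Rightarrow> 'a) rel" where
  "ultra_rel I D M =
     {(g, h). g \<in> (I \<rightarrow>\<^sub>E univ M) \<and> h \<in> (I \<rightarrow>\<^sub>E univ M) \<and> {i \<in> I. g i = h i} \<in> D}"

text \<open>
  The symbols are interpreted through representatives \<open>SOME g. g \<in> c\<close> of the classes \<open>c\<close>; for a
  filter \<open>D\<close> the result does not depend on their choice.
\<close>

definition ultrapower ::
  "'i set \<Rightarrow> 'i set set \<Rightarrow> ('f, 'r, 'a) fo_structure \<Rightarrow> ('f, 'r, ('i \<Rightarrow> 'a) set) fo_structure" where
  "ultrapower I D M =
     \<lparr> univ = (I \<rightarrow>\<^sub>E univ M) // ultra_rel I D M,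
       fun_interp = (\<lambda>f cs. ultra_rel I D M ``
         {\<lambda>i\<in>I. fun_interp M f (map (\<lambda>c. (SOME g. g \<in> c) i) cs)}),
       rel_interp = (\<lambda>r cs. {i \<in> I. rel_interp M r (map (\<lambda>c. (SOME g. g \<in> c) i) cs)} \<in> D) \<rparr>"

end

theory Submission
  imports Defs
begin

text \<open>
  Let \<open>\<phi>(x; y)\<close> have the order property. Since \<open>T\<close> is complete, every model \<open>M\<close> contains, for each
  finite \<open>n\<close>, a sequence of \<open>n\<close> parameter tuples that \<open>\<phi>\<close> can cut at every place: for each
  \<open>m \<le> n\<close> some \<open>x\<close> makes \<open>\<phi>\<close> fail at the members below \<open>m\<close> and hold at those from \<open>m\<close> on
  (\<open>order_property_cut_sequences\<close>). Regularity yields a function \<open>f\<close> from the index set to \<open>\<nat>\<close>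
  that represents a nonstandard number (\<open>regular_ultrafilter_nonstandard_nat\<close>). With a sequence
  of length \<open>f t\<close> at each index \<open>t\<close>, the ultrapower acquires an internal sequence \<open>(E g)\<close>,
  \<open>g < f\<close>, of nonstandard length, which can be cut at every internal place.

  Consider the type in \<open>x\<close> saying that \<open>\<phi>\<close> fails at all members with standard index and holds at
  all members with nonstandard index. It is finitely satisfiable, because a cut at a sufficiently
  large standard place satisfies finitely many of its conditions. It is not realized, because the
  set of standard numbers is not internal: for a realization, the first index at which \<open>\<phi>\<close> holds
  would be a least nonstandard number, but there is none. The type has at
  most as many parameters as there are functions from \<open>\<lambda>\<close> to \<open>\<nat>\<close>, that is \<open>2\<^sup>\<lambda>\<close>, so its omission
  refutes \<open>(2\<^sup>\<lambda>)\<^sup>+\<close>-saturation (\<open>ultrapower_not_saturated\<close>).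

  Two general facts connect this argument with the definitions: the theorem of Los, and the
  passage from saturation for one variable to types in finitely many variables
  (\<open>saturated_realizes_finite_tuple_types\<close>), which is required since \<open>x\<close> is a tuple.
\<close>

section \<open>Renaming variables and finite combinations of formulas\<close>

lemma eval_term_cong:
  "(\<And>v. v \<in> term_vars s \<Longrightarrow> e v = e' v) \<Longrightarrow> eval_term M e s = eval_term M e' s"
proof (induction s)
  case (Fun f ts)
  then have "map (eval_term M e) ts = map (eval_term M e') ts"
    by (intro map_cong) auto
  then show ?case by (simp only: eval_term.simps)
qed simp

lemma sat_cong:
  "(\<And>v. v \<in> free_vars \<phi> \<Longrightarrow> e v = e' v) \<Longrightarrow> sat M e \<phi> \<longleftrightarrow> sat M e' \<phi>"
proof (induction \<phi> arbitrary: e e')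
  case (Eq s t)
  then show ?case using eval_term_cong[of s e e' M] eval_term_cong[of t e e' M] by simp
next
  case (Rel r ts)
  then have "map (eval_term M e) ts = map (eval_term M e') ts"
    by (intro map_cong eval_term_cong) auto
  then show ?case by (simp only: sat.simps)
next
  case (Neg \<phi>)
  have "sat M e \<phi> \<longleftrightarrow> sat M e' \<phi>" by (rule Neg.IH) (simp add: Neg.prems)
  then show ?case by simp
next
  case (Conj \<phi> \<psi>)
  have "sat M e \<phi> \<longleftrightarrow> sat M e' \<phi>" "sat M e \<psi> \<longleftrightarrow> sat M e' \<psi>"
    by (rule Conj.IH, simp add: Conj.prems)+
  then show ?case by simp
next
  case (Exists n \<phi>)
  have "sat M (e(n := a)) \<phi> \<longleftrightarrow> sat M (e'(n := a)) \<phi>" for a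
    by (rule Exists.IH) (use Exists.prems in simp)
  then show ?case by simp
qed

lemma finite_term_vars: "finite (term_vars s)"
  by (induction s) auto

lemma finite_free_vars: "finite (free_vars \<phi>)"
  by (induction \<phi>) (auto simp: finite_term_vars)

primrec rename_term :: "(nat \<Rightarrow> nat) \<Rightarrow> 'f fo_term \<Rightarrow> 'f fo_term" where
  "rename_term \<pi> (Var n) = Var (\<pi> n)"
| "rename_term \<pi> (Fun f ts) = Fun f (map (rename_term \<pi>) ts)"

primrec rename :: "(nat \<Rightarrow> nat) \<Rightarrow> ('f, 'r) fo_formula \<Rightarrow> ('f, 'r) fo_formula" where
  "rename \<pi> (Eq s t) = Eq (rename_term \<pi> s) (rename_term \<pi> t)"
| "rename \<pi> (Rel r ts) = Rel r (map (rename_term \<pi>) ts)"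
| "rename \<pi> (Neg \<phi>) = Neg (rename \<pi> \<phi>)"
| "rename \<pi> (Conj \<phi> \<psi>) = Conj (rename \<pi> \<phi>) (rename \<pi> \<psi>)"
| "rename \<pi> (Exists n \<phi>) = Exists (\<pi> n) (rename \<pi> \<phi>)"

lemma is_term_rename_term: "is_term L s \<Longrightarrow> is_term L (rename_term \<pi> s)"
  by (induction s) auto

lemma is_formula_rename: "is_formula L \<phi> \<Longrightarrow> is_formula L (rename \<pi> \<phi>)"
  by (induction \<phi>) (auto simp: is_term_rename_term)

lemma term_vars_rename_term: "term_vars (rename_term \<pi> s) = \<pi> ` term_vars s"
  by (induction s) auto

lemma free_vars_rename: "inj \<pi> \<Longrightarrow> free_vars (rename \<pi> \<phi>) = \<pi> ` free_vars \<phi>"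
  by (induction \<phi>) (auto simp: term_vars_rename_term image_Un image_UN image_set_diff)

lemma eval_term_rename_term: "eval_term M e (rename_term \<pi> s) = eval_term M (e \<circ> \<pi>) s"
proof (induction s)
  case (Fun f ts)
  then have "map (eval_term M e) (map (rename_term \<pi>) ts) = map (eval_term M (e \<circ> \<pi>)) ts"
    unfolding map_map by (intro map_cong) (simp_all del: o_apply add: o_apply[of "eval_term M e"])
  then show ?case by (simp only: eval_term.simps rename_term.simps)
qed simp

text \<open>
  An injective renaming may be applied to bound variables as well, since it cannot identify a
  bound variable with a free one; so no capture has to be avoided.
\<close>

lemma sat_rename: "inj \<pi> \<Longrightarrow> sat M e (rename \<pi> \<phi>) \<longleftrightarrow> sat M (e \<circ> \<pi>) \<phi>"
proof (induction \<phi> arbitrary: e)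
  case (Rel r ts)
  have "map (eval_term M e) (map (rename_term \<pi>) ts) = map (eval_term M (e \<circ> \<pi>)) ts"
    by (simp add: eval_term_rename_term)
  then show ?case by (simp only: sat.simps rename.simps)
next
  case (Exists n \<phi>)
  have "sat M (e(\<pi> n := a)) (rename \<pi> \<phi>) \<longleftrightarrow> sat M ((e \<circ> \<pi>)(n := a)) \<phi>" for a
  proof -
    have "e(\<pi> n := a) \<circ> \<pi> = (e \<circ> \<pi>)(n := a)"
      using Exists.prems by (auto simp: fun_eq_iff inj_eq)
    then show ?thesis using Exists by (simp only:)
  qed
  then show ?case by (simp only: rename.simps sat.simps)
qed (auto simp: eval_term_rename_term)

primrec conjs :: "('f, 'r) fo_formula list \<Rightarrow> ('f, 'r) fo_formula" where
  "conjs [] = Exists 0 (Eq (Var 0) (Var 0))"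
| "conjs (\<phi> # \<phi>s) = Conj \<phi> (conjs \<phi>s)"

lemma is_formula_conjs: "is_formula L (conjs \<phi>s) \<longleftrightarrow> (\<forall>\<phi>\<in>set \<phi>s. is_formula L \<phi>)"
  by (induction \<phi>s) auto

lemma free_vars_conjs: "free_vars (conjs \<phi>s) = (\<Union>\<phi>\<in>set \<phi>s. free_vars \<phi>)"
  by (induction \<phi>s) auto

lemma sat_conjs: "univ M \<noteq> {} \<Longrightarrow> sat M e (conjs \<phi>s) \<longleftrightarrow> (\<forall>\<phi>\<in>set \<phi>s. sat M e \<phi>)"
  by (induction \<phi>s) auto

definition exs :: "nat set \<Rightarrow> ('f, 'r) fo_formula \<Rightarrow> ('f, 'r) fo_formula" where
  "exs V \<phi> = foldr Exists (sorted_list_of_set V) \<phi>"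

lemma is_formula_exs: "is_formula L (exs V \<phi>) \<longleftrightarrow> is_formula L \<phi>"
proof -
  have "is_formula L (foldr Exists vs \<phi>) \<longleftrightarrow> is_formula L \<phi>" for vs
    by (induction vs) auto
  then show ?thesis by (simp add: exs_def)
qed

lemma free_vars_exs: "finite V \<Longrightarrow> free_vars (exs V \<phi>) = free_vars \<phi> - V"
proof -
  have "free_vars (foldr Exists vs \<phi>) = free_vars \<phi> - set vs" for vs
    by (induction vs) auto
  then show "finite V \<Longrightarrow> ?thesis" by (simp add: exs_def)
qed

lemma sat_exs:
  assumes "finite V"
  shows "sat M e (exs V \<phi>) \<longleftrightarrow> (\<exists>b. b ` V \<subseteq> univ M \<and> sat M (override_on e b V) \<phi>)"
proof -
  have "sat M e (foldr Exists vs \<phi>) \<longleftrightarrow>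
      (\<exists>b. b ` set vs \<subseteq> univ M \<and> sat M (override_on e b (set vs)) \<phi>)" for vs
  proof (induction vs arbitrary: e)
    case (Cons v vs)
    show ?case (is "?l \<longleftrightarrow> ?r")
    proof
      assume ?l
      then obtain a b where ab: "a \<in> univ M" "b ` set vs \<subseteq> univ M"
        "sat M (override_on (e(v := a)) b (set vs)) \<phi>"
        using Cons.IH by (auto simp del: fun_upd_apply)
      define b' where "b' = override_on (\<lambda>_. a) b (set vs)"
      have "override_on (e(v := a)) b (set vs) = override_on e b' (set (v # vs))"
        by (auto simp: b'_def override_on_def fun_eq_iff)
      moreover have "b' ` set (v # vs) \<subseteq> univ M"
        using ab by (auto simp: b'_def override_on_def)
      ultimately show ?r using ab by auto
    next
      assume ?r
      then obtain b where b: "b ` set (v # vs) \<subseteq> univ M"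
        "sat M (override_on e b (set (v # vs))) \<phi>" by blast
      have "override_on e b (set (v # vs)) = override_on (e(v := b v)) b (set vs)"
        by (auto simp: override_on_def fun_eq_iff)
      then have "sat M (e(v := b v)) (foldr Exists vs \<phi>)"
        using Cons.IH b by (auto simp del: fun_upd_apply)
      then show ?l using b by (auto simp del: fun_upd_apply)
    qed
  qed simp
  from this[of "sorted_list_of_set V"] show ?thesis using assms by (simp add: exs_def)
qed

text \<open>
  Instances of formulas with different parameters are combined into one formula by giving each
  instance its own copy of the parameter variables, while the object variables \<open>X\<close> are shared.
  The offset makes the copies avoid \<open>X\<close>.
\<close>

definition copy_var :: "nat set \<Rightarrow> nat \<Rightarrow> nat \<Rightarrow> nat" where
  "copy_var X i v = (if v \<in> X then v else Suc (Max X) + prod_encode (i, v))"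

lemma copy_var_mem: "v \<in> X \<Longrightarrow> copy_var X i v = v"
  by (simp add: copy_var_def)

lemma copy_var_not_mem: "finite X \<Longrightarrow> v \<notin> X \<Longrightarrow> copy_var X i v \<notin> X"
  by (auto simp: copy_var_def dest: Max_ge)

lemma inj_copy_var: "finite X \<Longrightarrow> inj (copy_var X i)"
  using copy_var_mem copy_var_not_mem
  by (intro injI) (metis add_left_cancel copy_var_def prod.inject prod_encode_eq)

lemma override_on_comp_copy_var:
  "finite X \<Longrightarrow> override_on E b X \<circ> copy_var X i = override_on (E \<circ> copy_var X i) b X"
  by (auto simp: fun_eq_iff override_on_def copy_var_mem dest: copy_var_not_mem)

text \<open>
  Since the copies are disjoint, a single assignment can hold the parameters of all instances.
\<close>

lemma common_assignment:
  "\<exists>E. range E \<subseteq> (\<Union>i. range (a i)) \<and> (\<forall>i v. v \<notin> X \<longrightarrow> E (copy_var X i v) = a i v)"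
proof -
  define E where "E w = (case prod_decode (w - Suc (Max X)) of (i, v) \<Rightarrow> a i v)" for w
  have "E w \<in> (\<Union>i. range (a i))" for w
    by (cases "prod_decode (w - Suc (Max X))") (auto simp: E_def)
  moreover have "E (copy_var X i v) = a i v" if "v \<notin> X" for i v
    using that by (simp add: E_def copy_var_def)
  ultimately show ?thesis by blast
qed

lemma finite_conjunction_over:
  fixes M :: "('f, 'r, 'a) fo_structure"
  assumes "univ M \<noteq> {}" "finite X" "finite q" "q \<subseteq> formulas_over L X A"
  obtains \<psi> e where "(\<psi>, e) \<in> formulas_over L X A"
    "\<And>b. sat M (override_on e b X) \<psi> \<longleftrightarrow> (\<forall>(\<phi>, e')\<in>q. sat M (override_on e' b X) \<phi>)"
proof -
  obtain qs where qs: "set qs = q" using finite_list[OF assms(3)] by blast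
  obtain E where E: "\<And>i v. v \<notin> X \<Longrightarrow> E (copy_var X i v) = snd (qs ! i) v"
    using common_assignment[of "\<lambda>i. snd (qs ! i)" X] by blast
  define \<psi> where "\<psi> = conjs (map (\<lambda>i. rename (copy_var X i) (fst (qs ! i))) [0..<length qs])"
  have q: "qs ! i \<in> formulas_over L X A" if "i < length qs" for i
    using that assms(4) qs nth_mem by blast
  have "is_formula L \<psi>"
    using q by (auto simp: \<psi>_def is_formula_conjs formulas_over_def case_prod_beta
        intro!: is_formula_rename)
  moreover have "E ` (free_vars \<psi> - X) \<subseteq> A"
  proof clarify
    fix w assume w: "w \<in> free_vars \<psi>" "w \<notin> X"
    then obtain i v where i: "i < length qs" "v \<in> free_vars (fst (qs ! i))" "w = copy_var X i v"
      by (auto simp: \<psi>_def free_vars_conjs free_vars_rename[OF inj_copy_var[OF assms(2)]])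
    then have "v \<notin> X" using w copy_var_mem by metis
    then show "E w \<in> A" using q[OF i(1)] i E by (auto simp: formulas_over_def case_prod_beta)
  qed
  ultimately have "(\<psi>, E) \<in> formulas_over L X A" by (simp add: formulas_over_def)
  moreover have "sat M (override_on E b X) \<psi> \<longleftrightarrow>
    (\<forall>(\<phi>, e')\<in>q. sat M (override_on e' b X) \<phi>)" for b
  proof -
    have "override_on (E \<circ> copy_var X i) b X = override_on (snd (qs ! i)) b X" for i
      using E by (auto simp: override_on_def fun_eq_iff)
    then have "sat M (override_on E b X) \<psi> \<longleftrightarrow>
        (\<forall>i<length qs. sat M (override_on (snd (qs ! i)) b X) (fst (qs ! i)))"
      by (auto simp: \<psi>_def sat_conjs assms(1) sat_rename[OF inj_copy_var[OF assms(2)]]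
          override_on_comp_copy_var[OF assms(2)])
    also have "\<dots> \<longleftrightarrow> (\<forall>x\<in>set qs. sat M (override_on (snd x) b X) (fst x))"
      by (simp add: all_set_conv_all_nth)
    finally show ?thesis using qs by (auto simp: case_prod_beta)
  qed
  ultimately show thesis by (rule that)
qed

section \<open>Saturation for types in several variables\<close>

text \<open>
  To realize a type \<open>p(x, v)\<close>, first realize by \<open>b\<close> the type of all \<open>\<exists>v. \<And>q\<close> for finite
  \<open>q \<subseteq> p\<close>; then \<open>p(b, v)\<close> is finitely satisfiable, and it has only finitely many more parameters
  than \<open>p\<close>, so it is realized by one-variable saturation. The variable \<open>v\<close> must be
  interchanged with the variable \<open>0\<close> that the definition of saturation uses.
\<close>

lemma saturated_realizes_finite_tuple_types:
  fixes N :: "('f, 'r, 'a) fo_structure"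
  assumes sat: "saturated \<kappa> L N" and \<kappa>: "Cinfinite \<kappa>" and ne: "univ N \<noteq> {}"
    and A: "A \<subseteq> univ N" "|A| <o \<kappa>"
    and "finite X" "p \<subseteq> formulas_over L X A" "consistent_in N X p"
  shows "realized N X p"
  using assms(6-)
proof (induction X arbitrary: p)
  case empty
  have "sat N e \<phi>" if "(\<phi>, e) \<in> p" for \<phi> e
  proof -
    have "realized N {} {(\<phi>, e)}"
      using empty(2) that by (auto simp: consistent_in_def)
    then show ?thesis by (auto simp: realized_def)
  qed
  then show ?case by (auto simp: realized_def)
next
  case (insert v X)
  define V where "V = insert v X"
  have V: "finite V" using insert by (simp add: V_def)
  define comb where "comb q \<psi> e \<longleftrightarrow> (\<psi>, e) \<in> formulas_over L V A \<and>
     (\<forall>b. sat N (override_on e b V) \<psi> \<longleftrightarrow> (\<forall>(\<phi>, e')\<in>q. sat N (override_on e' b V) \<phi>))"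
    for q \<psi> and e :: "nat \<Rightarrow> 'a"
  have comb_ex: "\<exists>\<psi> e. comb q \<psi> e" if q: "finite q" "q \<subseteq> p" for q
  proof -
    have "q \<subseteq> formulas_over L V A" using q insert.prems by (simp add: V_def)
    from finite_conjunction_over[OF ne V q(1) this] obtain \<psi> e where
      "(\<psi>, e) \<in> formulas_over L V A"
      "\<And>b. sat N (override_on e b V) \<psi> \<longleftrightarrow> (\<forall>(\<phi>, e')\<in>q. sat N (override_on e' b V) \<phi>)"
      by blast
    then show ?thesis unfolding comb_def by blast
  qed
  define p1 where "p1 =
    {x. \<exists>\<psi> q. fst x = Exists v \<psi> \<and> finite q \<and> q \<subseteq> p \<and> comb q \<psi> (snd x)}"
  have "p1 \<subseteq> formulas_over L X A"
    by (auto simp: p1_def comb_def formulas_over_def V_def)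
  moreover have "consistent_in N X p1"
    unfolding consistent_in_def
  proof (intro allI impI)
    fix Q assume Q: "Q \<subseteq> p1" "finite Q"
    then have "\<forall>x\<in>Q. \<exists>\<psi> q. fst x = Exists v \<psi> \<and> finite q \<and> q \<subseteq> p \<and> comb q \<psi> (snd x)"
      unfolding p1_def by blast
    then obtain \<psi> q where q: "\<And>x. x \<in> Q \<Longrightarrow>
        fst x = Exists v (\<psi> x) \<and> finite (q x) \<and> q x \<subseteq> p \<and> comb (q x) (\<psi> x) (snd x)"
      by metis
    have "finite (\<Union>(q ` Q))" "\<Union>(q ` Q) \<subseteq> p" using Q q by blast+
    then have "realized N V (\<Union>(q ` Q))"
      using insert.prems(2) unfolding consistent_in_def V_def by blast
    then obtain b where b: "b ` V \<subseteq> univ N"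
      "\<And>x \<phi> e. x \<in> Q \<Longrightarrow> (\<phi>, e) \<in> q x \<Longrightarrow> sat N (override_on e b V) \<phi>"
      unfolding realized_def by fastforce
    have "sat N (override_on e b X) \<chi>" if x: "(\<chi>, e) \<in> Q" for \<chi> e
    proof -
      have "sat N (override_on e b V) (\<psi> (\<chi>, e))"
        using q[OF x] b(2)[OF x] by (auto simp: comb_def)
      moreover have "override_on e b V = (override_on e b X)(v := b v)"
        by (auto simp: V_def override_on_def fun_eq_iff)
      moreover have "b v \<in> univ N" using b by (auto simp: V_def)
      moreover have "\<chi> = Exists v (\<psi> (\<chi>, e))" using q[OF x] by simp
      ultimately show ?thesis by (metis sat.simps(5))
    qed
    then show "realized N X Q"
      using b(1) unfolding realized_def V_def by (intro exI[of _ b]) auto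
  qed
  ultimately have "realized N X p1" using insert.IH by blast
  then obtain b where b: "b ` X \<subseteq> univ N"
    "\<And>\<chi> e. (\<chi>, e) \<in> p1 \<Longrightarrow> sat N (override_on e b X) \<chi>"
    unfolding realized_def by fastforce
  define \<tau> where "\<tau> w = (if w = v then 0 else if w = 0 then v else w)" for w
  have \<tau>: "inj \<tau>" by (auto simp: \<tau>_def inj_def)
  define h where "h = (\<lambda>(\<phi>, e). (rename \<tau> \<phi>, override_on e b X \<circ> \<tau>) ::
      ('f, 'r) fo_formula \<times> (nat \<Rightarrow> 'a))"
  have swap: "sat N (override_on (override_on e b X \<circ> \<tau>) c {0}) (rename \<tau> \<phi>) \<longleftrightarrow>
      sat N (override_on e (b(v := c 0)) V) \<phi>" for \<phi> e c
  proof -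
    have "override_on (override_on e b X \<circ> \<tau>) c {0} \<circ> \<tau> = override_on e (b(v := c 0)) V"
      using insert.hyps by (auto simp: \<tau>_def V_def override_on_def fun_eq_iff)
    then show ?thesis by (simp add: sat_rename[OF \<tau>])
  qed
  have "h ` p \<subseteq> formulas_over L {0} (A \<union> b ` X)"
  proof (rule subrelI)
    fix \<chi> e' assume "(\<chi>, e') \<in> h ` p"
    then obtain \<phi> e where x: "(\<phi>, e) \<in> p" "\<chi> = rename \<tau> \<phi>" "e' = override_on e b X \<circ> \<tau>"
      by (auto simp: h_def)
    then have "(\<phi>, e) \<in> formulas_over L V A" using insert.prems(1) by (auto simp: V_def)
    then have \<phi>: "is_formula L \<phi>" "\<And>u. u \<in> free_vars \<phi> \<Longrightarrow> u \<notin> V \<Longrightarrow> e u \<in> A"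
      by (auto simp: formulas_over_def)
    have "e' (\<tau> u) \<in> A \<union> b ` X" if "u \<in> free_vars \<phi>" "\<tau> u \<noteq> 0" for u
    proof -
      have "u \<noteq> v" using that by (auto simp: \<tau>_def)
      moreover have "\<tau> (\<tau> u) = u" by (auto simp: \<tau>_def)
      ultimately show ?thesis using that \<phi>(2)[of u] x(3)
        by (auto simp: override_on_def V_def)
    qed
    then have "e' ` (free_vars \<chi> - {0}) \<subseteq> A \<union> b ` X"
      unfolding x(2) free_vars_rename[OF \<tau>] by blast
    then show "(\<chi>, e') \<in> formulas_over L {0} (A \<union> b ` X)"
      using \<phi>(1) x(2) by (auto simp: formulas_over_def is_formula_rename)
  qed
  moreover have "consistent_in N {0} (h ` p)"
    unfolding consistent_in_def
  proof (intro allI impI)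
    fix q2 assume "q2 \<subseteq> h ` p" "finite q2"
    then obtain q where q: "q \<subseteq> p" "finite q" "q2 = h ` q"
      using finite_subset_image by metis
    then obtain \<psi> e where \<psi>: "comb q \<psi> e" using comb_ex by blast
    then have "(Exists v \<psi>, e) \<in> p1" using q by (auto simp: p1_def)
    then obtain c where c: "c \<in> univ N" "sat N ((override_on e b X)(v := c)) \<psi>"
      using b(2) by fastforce
    have "(override_on e b X)(v := c) = override_on e (b(v := c)) V"
      using insert.hyps by (auto simp: V_def override_on_def fun_eq_iff)
    then have "\<forall>(\<phi>, e')\<in>q. sat N (override_on e' (b(v := c)) V) \<phi>"
      using c(2) \<psi> by (auto simp: comb_def)
    then show "realized N {0} q2"
      unfolding realized_def q(3) h_def using c(1) swap[where c="\<lambda>_. c"]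
      by (intro exI[of _ "\<lambda>_. c"]) auto
  qed
  moreover have "A \<union> b ` X \<subseteq> univ N" using A b by simp
  moreover have "|A \<union> b ` X| <o \<kappa>"
  proof -
    have "|b ` X| <o natLeq" using insert.hyps finite_iff_ordLess_natLeq by blast
    then have "|b ` X| <o \<kappa>" by (rule ordLess_ordLeq_trans[OF _ natLeq_ordLeq_cinfinite[OF \<kappa>]])
    then show ?thesis
      using card_of_Un_ordLess_infinite_Field[of \<kappa> A "b ` X"] A(2) \<kappa>
      by (auto simp: cinfinite_def)
  qed
  ultimately have "realized N {0} (h ` p)"
    using sat unfolding saturated_def by blast
  then obtain c where c: "c 0 \<in> univ N"
    "\<And>\<phi> e. (\<phi>, e) \<in> p \<Longrightarrow> sat N (override_on (override_on e b X \<circ> \<tau>) c {0}) (rename \<tau> \<phi>)"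
    unfolding realized_def h_def by fastforce
  then have "realized N V p"
    unfolding realized_def swap using b(1)
    by (intro exI[of _ "b(v := c 0)"]) (auto simp: V_def)
  then show ?case by (simp add: V_def)
qed

section \<open>Ultrapowers and their satisfaction relation\<close>

definition mostly :: "'i set \<Rightarrow> 'i set set \<Rightarrow> ('i \<Rightarrow> bool) \<Rightarrow> bool" where
  "mostly I D P \<longleftrightarrow> {t \<in> I. P t} \<in> D"

lemma mostly_mono:
  assumes "ultrafilter_on I D" "mostly I D P" "\<And>t. t \<in> I \<Longrightarrow> P t \<Longrightarrow> Q t"
  shows "mostly I D Q"
proof -
  have "{t \<in> I. P t} \<subseteq> {t \<in> I. Q t}" "{t \<in> I. Q t} \<subseteq> I" using assms(3) by auto
  then show ?thesis using assms(1,2) unfolding mostly_def ultrafilter_on_def by blast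
qed

lemma mostly_cong: "(\<And>t. t \<in> I \<Longrightarrow> P t \<longleftrightarrow> Q t) \<Longrightarrow> mostly I D P \<longleftrightarrow> mostly I D Q"
  unfolding mostly_def by (rule arg_cong[where f = "\<lambda>Y. Y \<in> D"]) auto

lemma mostly_True: "ultrafilter_on I D \<Longrightarrow> mostly I D (\<lambda>_. True)"
  by (simp add: mostly_def ultrafilter_on_def)

lemma mostly_conj:
  assumes "ultrafilter_on I D"
  shows "mostly I D (\<lambda>t. P t \<and> Q t) \<longleftrightarrow> mostly I D P \<and> mostly I D Q"
proof
  assume "mostly I D P \<and> mostly I D Q"
  then have "{t \<in> I. P t} \<inter> {t \<in> I. Q t} \<in> D"
    using assms unfolding mostly_def ultrafilter_on_def by blast
  moreover have "{t \<in> I. P t} \<inter> {t \<in> I. Q t} = {t \<in> I. P t \<and> Q t}" by auto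
  ultimately show "mostly I D (\<lambda>t. P t \<and> Q t)" by (simp add: mostly_def)
next
  assume a: "mostly I D (\<lambda>t. P t \<and> Q t)"
  show "mostly I D P \<and> mostly I D Q"
    by (intro conjI; rule mostly_mono[OF assms a]) auto
qed

lemma mostly_not:
  assumes "ultrafilter_on I D"
  shows "mostly I D (\<lambda>t. \<not> P t) \<longleftrightarrow> \<not> mostly I D P"
proof
  assume "mostly I D (\<lambda>t. \<not> P t)"
  then show "\<not> mostly I D P"
    using assms mostly_conj[OF assms, of P "\<lambda>t. \<not> P t"]
    by (auto simp: mostly_def ultrafilter_on_def)
next
  assume "\<not> mostly I D P"
  moreover have "I - {t \<in> I. P t} = {t \<in> I. \<not> P t}" by auto
  ultimately show "mostly I D (\<lambda>t. \<not> P t)"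
    using assms unfolding mostly_def ultrafilter_on_def
    by (metis (no_types, lifting) mem_Collect_eq subsetI)
qed

lemma mostly_ball_finite:
  assumes "ultrafilter_on I D" "finite S" "\<And>s. s \<in> S \<Longrightarrow> mostly I D (P s)"
  shows "mostly I D (\<lambda>t. \<forall>s\<in>S. P s t)"
  using assms(2,3) by (induction S) (auto simp: mostly_True mostly_conj assms(1))

lemma mostly_ex: "ultrafilter_on I D \<Longrightarrow> mostly I D P \<Longrightarrow> \<exists>t\<in>I. P t"
  by (rule ccontr) (auto simp: mostly_def ultrafilter_on_def)

abbreviation cls ::
  "'i set \<Rightarrow> 'i set set \<Rightarrow> ('f, 'r, 'a) fo_structure \<Rightarrow> ('i \<Rightarrow> 'a) \<Rightarrow> ('i \<Rightarrow> 'a) set" where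
  "cls I D M g \<equiv> ultra_rel I D M `` {g}"

lemma ultra_rel_iff:
  "(g, h) \<in> ultra_rel I D M \<longleftrightarrow>
     g \<in> (I \<rightarrow>\<^sub>E univ M) \<and> h \<in> (I \<rightarrow>\<^sub>E univ M) \<and> mostly I D (\<lambda>t. g t = h t)"
  by (simp add: ultra_rel_def mostly_def)

lemma equiv_ultra_rel:
  assumes U: "ultrafilter_on I D"
  shows "equiv (I \<rightarrow>\<^sub>E univ M) (ultra_rel I D M)"
proof (rule equivI)
  show "refl_on (I \<rightarrow>\<^sub>E univ M) (ultra_rel I D M)"
    by (auto simp: refl_on_def ultra_rel_iff mostly_True[OF U])
  show "sym (ultra_rel I D M)"
    by (auto simp: sym_def ultra_rel_iff eq_commute)
  show "trans (ultra_rel I D M)"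
  proof (rule transI)
    fix g h k assume gh: "(g, h) \<in> ultra_rel I D M" "(h, k) \<in> ultra_rel I D M"
    then have "mostly I D (\<lambda>t. g t = h t \<and> h t = k t)"
      by (simp add: ultra_rel_iff mostly_conj[OF U])
    then have "mostly I D (\<lambda>t. g t = k t)" by (rule mostly_mono[OF U]) simp
    then show "(g, k) \<in> ultra_rel I D M" using gh by (simp add: ultra_rel_iff)
  qed
  show "ultra_rel I D M \<subseteq> (I \<rightarrow>\<^sub>E univ M) \<times> (I \<rightarrow>\<^sub>E univ M)"
    by (auto simp: ultra_rel_iff)
qed

lemma cls_eq_iff:
  assumes "ultrafilter_on I D" "g \<in> (I \<rightarrow>\<^sub>E univ M)" "h \<in> (I \<rightarrow>\<^sub>E univ M)"
  shows "cls I D M g = cls I D M h \<longleftrightarrow> mostly I D (\<lambda>t. g t = h t)"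
  using eq_equiv_class_iff[OF equiv_ultra_rel[OF assms(1)] assms(2,3)] assms(2,3)
  by (simp add: ultra_rel_iff)

lemma univ_ultrapower: "univ (ultrapower I D M) = cls I D M ` (I \<rightarrow>\<^sub>E univ M)"
  by (auto simp: ultrapower_def quotient_def)

lemma representative:
  assumes "ultrafilter_on I D" "g \<in> (I \<rightarrow>\<^sub>E univ M)"
  shows "(SOME h. h \<in> cls I D M g) \<in> (I \<rightarrow>\<^sub>E univ M)"
    and "mostly I D (\<lambda>t. (SOME h. h \<in> cls I D M g) t = g t)"
proof -
  have "g \<in> cls I D M g" using assms by (simp add: ultra_rel_iff mostly_True)
  then have "(SOME h. h \<in> cls I D M g) \<in> cls I D M g"
    by (rule someI[where P = "\<lambda>h. h \<in> cls I D M g"])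
  then show "(SOME h. h \<in> cls I D M g) \<in> (I \<rightarrow>\<^sub>E univ M)"
    and "mostly I D (\<lambda>t. (SOME h. h \<in> cls I D M g) t = g t)"
    by (auto simp: ultra_rel_iff eq_commute)
qed

lemma eval_term_in_univ:
  assumes "is_structure L M" "is_term L s" "range e \<subseteq> univ M"
  shows "eval_term M e s \<in> univ M"
  using assms(2)
proof (induction s)
  case (Fun f ts)
  then have "set (map (eval_term M e) ts) \<subseteq> univ M" by auto
  then show ?case using Fun.prems assms(1) by (simp add: is_structure_def)
qed (use assms in auto)

text \<open>
  The interpretation of a function symbol evaluates chosen representatives of its arguments. Each
  of them agrees almost everywhere with the expected function, and since there are only finitely
  many arguments, they do so simultaneously almost everywhere.
\<close>

lemma eval_term_ultrapower:
  assumes U: "ultrafilter_on I D" and M: "is_structure L M"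
    and g: "\<And>v. g v \<in> (I \<rightarrow>\<^sub>E univ M)" and "is_term L s"
  shows "eval_term (ultrapower I D M) (\<lambda>v. cls I D M (g v)) s =
     cls I D M (\<lambda>t\<in>I. eval_term M (\<lambda>v. g v t) s)"
  using assms(4)
proof (induction s)
  case (Var n)
  have "(\<lambda>t\<in>I. g n t) = g n" using g[of n] by auto
  then show ?case by simp
next
  case (Fun f ts)
  let ?U = "ultrapower I D M" and ?e = "\<lambda>v. cls I D M (g v)"
  let ?rep = "\<lambda>c. SOME h. h \<in> c"
  have in_univ: "eval_term M (\<lambda>v. g v t) s \<in> univ M" if "t \<in> I" "is_term L s" for s t
    using g that by (intro eval_term_in_univ[OF M]) auto
  have s: "?rep (eval_term ?U ?e s) \<in> (I \<rightarrow>\<^sub>E univ M)"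
    "mostly I D (\<lambda>t. ?rep (eval_term ?U ?e s) t = eval_term M (\<lambda>v. g v t) s)"
    if "s \<in> set ts" for s
  proof -
    have eq: "eval_term ?U ?e s = cls I D M (\<lambda>t\<in>I. eval_term M (\<lambda>v. g v t) s)"
      using that Fun.prems by (intro Fun.IH) auto
    have mem: "(\<lambda>t\<in>I. eval_term M (\<lambda>v. g v t) s) \<in> (I \<rightarrow>\<^sub>E univ M)"
      using in_univ Fun.prems that by auto
    show "?rep (eval_term ?U ?e s) \<in> (I \<rightarrow>\<^sub>E univ M)"
      unfolding eq by (rule representative[OF U mem])
    show "mostly I D (\<lambda>t. ?rep (eval_term ?U ?e s) t = eval_term M (\<lambda>v. g v t) s)"
      unfolding eq by (rule mostly_mono[OF U representative(2)[OF U mem]]) simp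
  qed
  let ?l = "\<lambda>t\<in>I. fun_interp M f (map (\<lambda>c. ?rep c t) (map (eval_term ?U ?e) ts))"
  let ?r = "\<lambda>t\<in>I. eval_term M (\<lambda>v. g v t) (Fun f ts)"
  have "?l \<in> (I \<rightarrow>\<^sub>E univ M)"
  proof (rule restrict_PiE_iff[THEN iffD2], rule ballI)
    fix t assume t: "t \<in> I"
    have "set (map (\<lambda>c. ?rep c t) (map (eval_term ?U ?e) ts)) \<subseteq> univ M"
      using PiE_mem[OF s(1) t] by auto
    then show "fun_interp M f (map (\<lambda>c. ?rep c t) (map (eval_term ?U ?e) ts)) \<in> univ M"
      using M Fun.prems by (simp add: is_structure_def)
  qed
  moreover have "?r \<in> (I \<rightarrow>\<^sub>E univ M)"
    using in_univ[OF _ Fun.prems] by (auto simp del: eval_term.simps)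
  moreover have "mostly I D (\<lambda>t. ?l t = ?r t)"
  proof (rule mostly_mono[OF U])
    show "mostly I D (\<lambda>t. \<forall>s\<in>set ts. ?rep (eval_term ?U ?e s) t = eval_term M (\<lambda>v. g v t) s)"
      by (rule mostly_ball_finite[OF U]) (use s in auto)
    fix t assume "t \<in> I" "\<forall>s\<in>set ts. ?rep (eval_term ?U ?e s) t = eval_term M (\<lambda>v. g v t) s"
    then have "map (\<lambda>c. ?rep c t) (map (eval_term ?U ?e) ts) = map (eval_term M (\<lambda>v. g v t)) ts"
      by simp
    then show "?l t = ?r t" using \<open>t \<in> I\<close> by (simp only: eval_term.simps restrict_apply)
  qed
  ultimately have "cls I D M ?l = cls I D M ?r" by (simp only: cls_eq_iff[OF U])
  moreover have "eval_term ?U ?e (Fun f ts) = cls I D M ?l"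
    by (simp add: ultrapower_def)
  ultimately show ?case by (simp only:)
qed

theorem los:
  assumes U: "ultrafilter_on I D" and M: "is_structure L M"
    and "\<And>v. g v \<in> (I \<rightarrow>\<^sub>E univ M)" and "is_formula L \<phi>"
  shows "sat (ultrapower I D M) (\<lambda>v. cls I D M (g v)) \<phi> \<longleftrightarrow>
     mostly I D (\<lambda>t. sat M (\<lambda>v. g v t) \<phi>)"
  using assms(3,4)
proof (induction \<phi> arbitrary: g)
  case (Eq s s')
  have mem: "(\<lambda>t\<in>I. eval_term M (\<lambda>v. g v t) u) \<in> (I \<rightarrow>\<^sub>E univ M)" if "is_term L u" for u
    using Eq.prems(1) by (auto intro!: eval_term_in_univ[OF M that])
  have "mostly I D (\<lambda>t. (\<lambda>t\<in>I. eval_term M (\<lambda>v. g v t) s) t =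
      (\<lambda>t\<in>I. eval_term M (\<lambda>v. g v t) s') t) \<longleftrightarrow>
    mostly I D (\<lambda>t. eval_term M (\<lambda>v. g v t) s = eval_term M (\<lambda>v. g v t) s')"
    by (rule mostly_cong) simp
  then show ?case
    using Eq.prems by (simp add: eval_term_ultrapower[OF U M] cls_eq_iff[OF U mem mem])
next
  case (Rel r ts)
  let ?U = "ultrapower I D M" and ?e = "\<lambda>v. cls I D M (g v)"
  let ?rep = "\<lambda>c. SOME h. h \<in> c"
  have s: "mostly I D (\<lambda>t. ?rep (eval_term ?U ?e s) t = eval_term M (\<lambda>v. g v t) s)"
    if "s \<in> set ts" for s
  proof -
    have "is_term L s" using that Rel.prems by simp
    then have mem: "(\<lambda>t\<in>I. eval_term M (\<lambda>v. g v t) s) \<in> (I \<rightarrow>\<^sub>E univ M)"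
      using Rel.prems(1) by (auto intro!: eval_term_in_univ[OF M])
    show ?thesis
      unfolding eval_term_ultrapower[OF U M Rel.prems(1) \<open>is_term L s\<close>]
      by (rule mostly_mono[OF U representative(2)[OF U mem]]) simp
  qed
  have all: "mostly I D (\<lambda>t. map (\<lambda>c. ?rep c t) (map (eval_term ?U ?e) ts) =
      map (eval_term M (\<lambda>v. g v t)) ts)"
    by (rule mostly_mono[OF U mostly_ball_finite[OF U _ s]]) auto
  have "sat ?U ?e (Rel r ts) \<longleftrightarrow>
      mostly I D (\<lambda>t. rel_interp M r (map (\<lambda>c. ?rep c t) (map (eval_term ?U ?e) ts)))"
    by (simp add: ultrapower_def mostly_def)
  also have "\<dots> \<longleftrightarrow> mostly I D (\<lambda>t. rel_interp M r (map (eval_term M (\<lambda>v. g v t)) ts))"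
    using all mostly_conj[OF U] mostly_mono[OF U] by (smt (verit))
  finally show ?case by simp
next
  case (Neg \<phi>)
  then show ?case by (simp add: mostly_not[OF U])
next
  case (Conj \<phi> \<psi>)
  then show ?case by (simp add: mostly_conj[OF U])
next
  case (Exists n \<phi>)
  have "is_formula L \<phi>" using Exists.prems by simp
  have step: "sat (ultrapower I D M) ((\<lambda>v. cls I D M (g v))(n := cls I D M h)) \<phi> \<longleftrightarrow>
      mostly I D (\<lambda>t. sat M ((\<lambda>v. g v t)(n := h t)) \<phi>)" if "h \<in> (I \<rightarrow>\<^sub>E univ M)" for h
  proof -
    have "(\<lambda>v. cls I D M (g v))(n := cls I D M h) = (\<lambda>v. cls I D M ((g(n := h)) v))"
      by (simp add: fun_eq_iff)
    moreover have "(\<lambda>v. g v t)(n := h t) = (\<lambda>v. (g(n := h)) v t)" for t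
      by (simp add: fun_eq_iff)
    moreover have "sat (ultrapower I D M) (\<lambda>v. cls I D M ((g(n := h)) v)) \<phi> \<longleftrightarrow>
        mostly I D (\<lambda>t. sat M (\<lambda>v. (g(n := h)) v t) \<phi>)"
      by (rule Exists.IH) (use Exists.prems that in auto)
    ultimately show ?thesis by (simp only:)
  qed
  show ?case
  proof
    assume "sat (ultrapower I D M) (\<lambda>v. cls I D M (g v)) (Exists n \<phi>)"
    then obtain h where h: "h \<in> (I \<rightarrow>\<^sub>E univ M)"
      "sat (ultrapower I D M) ((\<lambda>v. cls I D M (g v))(n := cls I D M h)) \<phi>"
      by (auto simp: univ_ultrapower)
    then have "mostly I D (\<lambda>t. sat M ((\<lambda>v. g v t)(n := h t)) \<phi>)" using step by blast
    then show "mostly I D (\<lambda>t. sat M (\<lambda>v. g v t) (Exists n \<phi>))"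
      by (rule mostly_mono[OF U]) (use h(1) in auto)
  next
    assume m: "mostly I D (\<lambda>t. sat M (\<lambda>v. g v t) (Exists n \<phi>))"
    \<comment> \<open>indices without a witness get an arbitrary element of \<open>M\<close>, so that \<open>h\<close> lies in the power\<close>
    define h where "h = (\<lambda>t\<in>I. if sat M (\<lambda>v. g v t) (Exists n \<phi>)
      then SOME a. a \<in> univ M \<and> sat M ((\<lambda>v. g v t)(n := a)) \<phi> else SOME a. a \<in> univ M)"
    have h: "h t \<in> univ M" "sat M (\<lambda>v. g v t) (Exists n \<phi>) \<Longrightarrow> sat M ((\<lambda>v. g v t)(n := h t)) \<phi>"
      if "t \<in> I" for t
    proof -
      have ne: "(SOME a. a \<in> univ M) \<in> univ M" using M by (auto simp: is_structure_def some_in_eq)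
      have ex: "h t \<in> univ M \<and> sat M ((\<lambda>v. g v t)(n := h t)) \<phi>"
        if "sat M (\<lambda>v. g v t) (Exists n \<phi>)"
      proof -
        have "\<exists>a. a \<in> univ M \<and> sat M ((\<lambda>v. g v t)(n := a)) \<phi>" using that by auto
        from someI_ex[OF this] show ?thesis
          using that \<open>t \<in> I\<close> by (simp only: h_def restrict_apply' if_True)
      qed
      show "h t \<in> univ M" using ex ne \<open>t \<in> I\<close>
        by (cases "sat M (\<lambda>v. g v t) (Exists n \<phi>)") (auto simp: h_def)
      show "sat M (\<lambda>v. g v t) (Exists n \<phi>) \<Longrightarrow> sat M ((\<lambda>v. g v t)(n := h t)) \<phi>"
        using ex by blast
    qed
    have hm: "h \<in> (I \<rightarrow>\<^sub>E univ M)" using h(1) by (auto simp: h_def)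
    have "mostly I D (\<lambda>t. sat M ((\<lambda>v. g v t)(n := h t)) \<phi>)"
      by (rule mostly_mono[OF U m h(2)])
    then have "sat (ultrapower I D M) ((\<lambda>v. cls I D M (g v))(n := cls I D M h)) \<phi>"
      using step[OF hm] by simp
    then show "sat (ultrapower I D M) (\<lambda>v. cls I D M (g v)) (Exists n \<phi>)"
      using hm by (auto simp: univ_ultrapower)
  qed
qed

text \<open>
  The number of sets of a regularizing family that contain \<open>t\<close> is finite, but \<open>D\<close>-almost
  everywhere at least \<open>k\<close>, because \<open>D\<close> contains the intersection of any \<open>k\<close> of the sets. So this
  number, as a function of \<open>t\<close>, is a nonstandard element of the ultrapower of \<open>\<nat>\<close>.
\<close>

lemma regular_ultrafilter_nonstandard_nat:
  assumes "infinite (Field lam)" "regular_ultrafilter lam D"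
  obtains f :: "'i \<Rightarrow> nat" where "\<And>k. mostly (Field lam) D (\<lambda>t. k \<le> f t)"
proof -
  let ?I = "Field lam"
  obtain X where U: "ultrafilter_on ?I D" and X: "\<And>i. i \<in> ?I \<Longrightarrow> X i \<in> D"
    "\<And>t. t \<in> ?I \<Longrightarrow> finite {i \<in> ?I. t \<in> X i}"
    using assms(2) unfolding regular_ultrafilter_def by blast
  have "mostly ?I D (\<lambda>t. k \<le> card {i \<in> ?I. t \<in> X i})" for k
  proof -
    obtain J where J: "finite J" "card J = k" "J \<subseteq> ?I"
      using infinite_arbitrarily_large[OF assms(1)] by blast
    have "mostly ?I D (\<lambda>t. t \<in> X j)" if "j \<in> J" for j
    proof -
      have "X j \<in> D" using that J X by blast
      moreover from this have "X j \<subseteq> ?I" using U by (auto simp: ultrafilter_on_def)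
      ultimately show ?thesis by (simp add: mostly_def Collect_conj_eq Int_absorb1)
    qed
    then have "mostly ?I D (\<lambda>t. \<forall>j\<in>J. t \<in> X j)" by (rule mostly_ball_finite[OF U J(1)])
    then show ?thesis
    proof (rule mostly_mono[OF U])
      fix t assume t: "t \<in> ?I" "\<forall>j\<in>J. t \<in> X j"
      then have "J \<subseteq> {i \<in> ?I. t \<in> X i}" using J by auto
      then show "k \<le> card {i \<in> ?I. t \<in> X i}" using card_mono X(2)[OF t(1)] J(2) by metis
    qed
  qed
  then show thesis by (rule that)
qed

section \<open>Unstable theories\<close>

text \<open>
  The free variables of this formula code a sequence of \<open>n\<close> parameter tuples, the \<open>i\<close>-th tuple
  being held by the \<open>i\<close>-th copies of the parameter variables of \<open>\<phi>\<close>. The formula says that \<open>\<phi>\<close>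
  can cut the sequence into an initial segment where it fails and a rest where it holds, at
  every place.
\<close>

definition cuts_formula ::
  "('f, 'r) fo_formula \<Rightarrow> nat set \<Rightarrow> nat \<Rightarrow> ('f, 'r) fo_formula" where
  "cuts_formula \<phi> X n = conjs (map (\<lambda>m. exs X (conjs (map (\<lambda>i.
     if m \<le> i then rename (copy_var X i) \<phi> else Neg (rename (copy_var X i) \<phi>)) [0..<n])))
     [0..<Suc n])"

lemma is_formula_cuts_formula: "is_formula L \<phi> \<Longrightarrow> is_formula L (cuts_formula \<phi> X n)"
  by (auto simp: cuts_formula_def is_formula_conjs is_formula_exs is_formula_rename
      simp del: upt_Suc)

lemma sat_cuts_formula:
  assumes "univ M \<noteq> {}" "finite X"
  shows "sat M E (cuts_formula \<phi> X n) \<longleftrightarrow> (\<forall>m\<le>n. \<exists>b. b ` X \<subseteq> univ M \<and>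
    (\<forall>i<n. sat M (override_on (E \<circ> copy_var X i) b X) \<phi> \<longleftrightarrow> m \<le> i))"
proof -
  define cut where "cut m i =
    (if m \<le> i then rename (copy_var X i) \<phi> else Neg (rename (copy_var X i) \<phi>))" for m i
  have cut: "sat M e (cut m i) \<longleftrightarrow> (sat M (e \<circ> copy_var X i) \<phi> \<longleftrightarrow> m \<le> i)" for e m i
    using assms(2) by (simp add: cut_def sat_rename inj_copy_var)
  have "cuts_formula \<phi> X n = conjs (map (\<lambda>m. exs X (conjs (map (cut m) [0..<n]))) [0..<Suc n])"
    unfolding cuts_formula_def cut_def ..
  then have "sat M E (cuts_formula \<phi> X n) \<longleftrightarrow> (\<forall>m\<in>{0..<Suc n}. \<exists>b. b ` X \<subseteq> univ M \<and>
      (\<forall>i\<in>{0..<n}. sat M (override_on (E \<circ> copy_var X i) b X) \<phi> \<longleftrightarrow> m \<le> i))"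
    by (simp add: sat_conjs[OF assms(1)] sat_exs[OF assms(2)] cut
        override_on_comp_copy_var[OF assms(2)] del: upt_Suc)
  then show ?thesis by (simp add: Ball_def less_Suc_eq_le)
qed

definition cut_everywhere ::
  "('f, 'r, 'a) fo_structure \<Rightarrow> ('f, 'r) fo_formula \<Rightarrow> nat set \<Rightarrow> nat \<Rightarrow> (nat \<Rightarrow> nat \<Rightarrow> 'a) \<Rightarrow> bool"
  where "cut_everywhere M \<phi> X n a \<longleftrightarrow> (\<forall>i. range (a i) \<subseteq> univ M) \<and>
    (\<forall>m\<le>n. \<exists>b. b ` X \<subseteq> univ M \<and> (\<forall>i<n. sat M (override_on (a i) b X) \<phi> \<longleftrightarrow> m \<le> i))"

text \<open>
  The existence of a sequence of length \<open>n\<close> which \<open>\<phi>\<close> cuts everywhere is expressed by a sentence,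
  so it passes from a model with the order property to all models of a complete theory.
\<close>

lemma order_property_cut_sequences:
  fixes N :: "('f, 'r, 'u) fo_structure" and M :: "('f, 'r, 'a) fo_structure"
  assumes T: "complete_theory L T" and N: "is_model L N T" and M: "is_model L M T"
    and \<phi>: "is_formula L \<phi>" and X: "finite X" and op: "order_property N \<phi> X"
  shows "\<exists>a. cut_everywhere M \<phi> X n a"
proof -
  have ne: "univ N \<noteq> {}" "univ M \<noteq> {}" using N M by (auto simp: is_model_def is_structure_def)
  define \<chi> where "\<chi> = cuts_formula \<phi> X n"
  define \<sigma> where "\<sigma> = exs (free_vars \<chi>) \<chi>"
  have sentence: "is_sentence L \<sigma>"
    using \<phi> by (simp add: \<sigma>_def \<chi>_def is_sentence_def is_formula_exs is_formula_cuts_formula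
        free_vars_exs finite_free_vars)
  obtain a :: "nat \<Rightarrow> nat \<Rightarrow> 'u" where a: "\<And>i. range (a i) \<subseteq> univ N"
    "\<And>m. consistent_in N X ({(Neg \<phi>, a i) | i. i < m} \<union> {(\<phi>, a j) | j. m \<le> j})"
    using op unfolding order_property_def by (elim exE conjE) (rule that; erule spec)
  obtain E where E: "range E \<subseteq> (\<Union>i. range (a i))"
    "\<And>i v. v \<notin> X \<Longrightarrow> E (copy_var X i v) = a i v"
    using common_assignment[of a X] by blast
  have ext: "override_on (E \<circ> copy_var X i) b X = override_on (a i) b X" for b i
    by (auto simp: override_on_def fun_eq_iff E(2))
  have "\<exists>b. b ` X \<subseteq> univ N \<and> (\<forall>i<n. sat N (override_on (a i) b X) \<phi> \<longleftrightarrow> m \<le> i)" for m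
  proof -
    define q where "q = (\<lambda>i. (if m \<le> i then \<phi> else Neg \<phi>, a i)) ` {..<n}"
    have "q \<subseteq> {(Neg \<phi>, a i) | i. i < m} \<union> {(\<phi>, a j) | j. m \<le> j}" "finite q"
    proof -
      have "(if m \<le> i then \<phi> else Neg \<phi>, a i) \<in>
          {(Neg \<phi>, a i) | i. i < m} \<union> {(\<phi>, a j) | j. m \<le> j}" for i
      proof (cases "m \<le> i")
        case True
        then show ?thesis by (simp only: if_True) blast
      next
        case False
        then have "i < m" by simp
        with False show ?thesis by (simp only: if_False) blast
      qed
      then show "q \<subseteq> {(Neg \<phi>, a i) | i. i < m} \<union> {(\<phi>, a j) | j. m \<le> j}"
        unfolding q_def by (rule image_subsetI)
    qed (simp add: q_def)
    then have "realized N X q" using a(2)[of m] by (simp only: consistent_in_def)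
    then obtain b where b: "b ` X \<subseteq> univ N"
      "\<forall>i<n. sat N (override_on (a i) b X) (if m \<le> i then \<phi> else Neg \<phi>)"
      by (auto simp: realized_def q_def)
    then have "\<forall>i<n. sat N (override_on (a i) b X) \<phi> \<longleftrightarrow> m \<le> i"
      by (auto split: if_splits)
    then show ?thesis using b(1) by blast
  qed
  then have "sat N E \<chi>" by (simp add: \<chi>_def sat_cuts_formula[OF ne(1) X] ext)
  moreover have "sat N (override_on e E (free_vars \<chi>)) \<chi> \<longleftrightarrow> sat N E \<chi>" for e
    by (rule sat_cong) simp
  moreover have "E ` free_vars \<chi> \<subseteq> univ N" using E(1) a(1) by blast
  ultimately have "sat N e \<sigma>" for e
    unfolding \<sigma>_def sat_exs[OF finite_free_vars] by blast
  note \<sigma> = this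
  obtain d where "d \<in> univ N" using ne by blast
  have "Neg \<sigma> \<notin> T"
  proof
    assume "Neg \<sigma> \<in> T"
    then have "sat N (\<lambda>_. d) (Neg \<sigma>)"
      using N \<open>d \<in> univ N\<close> by (auto simp: is_model_def simp del: sat.simps)
    then show False using \<sigma> by simp
  qed
  then have "\<sigma> \<in> T" using T sentence by (auto simp: complete_theory_def)
  obtain c where "c \<in> univ M" using ne by blast
  then have "sat M (\<lambda>_. c) \<sigma>" using M \<open>\<sigma> \<in> T\<close> by (auto simp: is_model_def)
  then obtain b where b: "b ` free_vars \<chi> \<subseteq> univ M"
    "sat M (override_on (\<lambda>_. c) b (free_vars \<chi>)) \<chi>"
    by (auto simp: \<sigma>_def sat_exs finite_free_vars)
  define e where "e = override_on (\<lambda>_. c) b (free_vars \<chi>)"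
  have e: "range e \<subseteq> univ M" using b(1) \<open>c \<in> univ M\<close> by (auto simp: e_def override_on_def)
  have "\<forall>m\<le>n. \<exists>b. b ` X \<subseteq> univ M \<and>
      (\<forall>i<n. sat M (override_on (e \<circ> copy_var X i) b X) \<phi> \<longleftrightarrow> m \<le> i)"
    using b(2) by (simp add: \<chi>_def e_def[unfolded \<chi>_def] sat_cuts_formula[OF ne(2) X])
  moreover have "range (e \<circ> copy_var X i) \<subseteq> univ M" for i using e by auto
  ultimately show ?thesis
    by (intro exI[of _ "\<lambda>i. e \<circ> copy_var X i"]) (simp only: cut_everywhere_def simp_thms)
qed

section \<open>An omitted type\<close>

lemma nat_functions_ordLeq:
  assumes "Cinfinite lam"
  shows "|Func (Field lam) (UNIV :: nat set)| \<le>o ctwo ^c lam"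
proof -
  have "Cinfinite (ctwo ^c lam)"
    using assms Cinfinite_cexp ordLeq_refl[OF Card_order_ctwo] by blast
  then have "natLeq ^c lam \<le>o (ctwo ^c lam) ^c lam"
    using assms by (intro cexp_mono1 natLeq_ordLeq_cinfinite) auto
  also have "(ctwo ^c lam) ^c lam =o ctwo ^c lam"
    using assms Cinfinite_Cnotzero ordLeq_refl by (intro cexp_cprod_ordLeq Card_order_ctwo) blast+
  finally show ?thesis by (simp add: cexp_def Field_natLeq)
qed

text \<open>
  At index \<open>t\<close> there is a sequence \<open>a (f t)\<close> of length \<open>f t\<close> that \<open>\<phi>\<close> can cut at every place, so
  in the ultrapower there is an internal sequence of nonstandard length \<open>f\<close>; its members are
  the tuples \<open>E g\<close> for \<open>g < f\<close>. The type says that \<open>\<phi>\<close> fails at all standard members and holds at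
  all nonstandard ones. Finitely many of these conditions are met by an internal cut at a
  standard \<open>K\<close>. But a realization would make the set of standard numbers internal: the least
  member at which \<open>\<phi>\<close> holds (or the last member) would have a nonstandard index \<open>h\<close>, although
  \<open>\<phi>\<close> would have to hold already at \<open>h - 1\<close>.
\<close>

lemma ultrapower_not_saturated:
  fixes lam :: "'i rel" and M :: "('f, 'r, 'a) fo_structure" and f :: "'i \<Rightarrow> nat"
  assumes lam: "Cinfinite lam" and U: "ultrafilter_on (Field lam) D"
    and f: "\<And>k. mostly (Field lam) D (\<lambda>t. k \<le> f t)"
    and M: "is_structure L M" and \<phi>: "is_formula L \<phi>" and X: "finite X"
    and seq: "\<And>n. \<exists>a. cut_everywhere M \<phi> X n a"
  shows "\<not> saturated (cardSuc (ctwo ^c lam)) L (ultrapower (Field lam) D M)"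
proof
  let ?I = "Field lam" and ?U = "ultrapower (Field lam) D M"
  assume saturated: "saturated (cardSuc (ctwo ^c lam)) L ?U"
  obtain a where "\<And>n. cut_everywhere M \<phi> X n (a n)" using seq by metis
  then have in_univ: "a n i v \<in> univ M"
    and cut: "m \<le> n \<Longrightarrow> \<exists>b. b ` X \<subseteq> univ M \<and>
      (\<forall>i<n. sat M (override_on (a n i) b X) \<phi> \<longleftrightarrow> m \<le> i)" for n i v m
    unfolding cut_everywhere_def by blast+
  define E where "E g v = cls ?I D M (\<lambda>t\<in>?I. a (f t) (g t) v)" for g v
  have member: "(\<lambda>t\<in>?I. a (f t) (g t) v) \<in> (?I \<rightarrow>\<^sub>E univ M)" for g v
    using in_univ by auto
  define A where "A = (\<Union>g. range (E g))"
  have "E g v \<in> univ ?U" for g v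
    unfolding E_def univ_ultrapower by (rule imageI) (rule member)
  then have A: "A \<subseteq> univ ?U" by (auto simp: A_def)
  have inf: "Cinfinite (ctwo ^c lam)"
    using lam Cinfinite_cexp ordLeq_refl[OF Card_order_ctwo] by blast
  \<comment> \<open>\<open>E g\<close> depends only on the values of \<open>g\<close> on the index set\<close>
  have "|A| \<le>o ctwo ^c lam"
  proof -
    have "A \<subseteq> (\<lambda>(g, v). E g v) ` (Func ?I UNIV \<times> UNIV)"
    proof
      fix c assume "c \<in> A"
      then obtain g v where c: "c = E g v" by (auto simp: A_def)
      have "(\<lambda>t\<in>?I. a (f t) (restrict g ?I t) v) = (\<lambda>t\<in>?I. a (f t) (g t) v)"
        by (rule restrict_ext) simp
      then have "E g v = E (restrict g ?I) v" by (simp only: E_def)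
      moreover have "restrict g ?I \<in> Func ?I UNIV" by (simp add: Func_def)
      ultimately show "c \<in> (\<lambda>(g, v). E g v) ` (Func ?I UNIV \<times> UNIV)"
        using c by (intro image_eqI[of _ _ "(restrict g ?I, v)"]) auto
    qed
    then have "|A| \<le>o |Func ?I (UNIV :: nat set) \<times> (UNIV :: nat set)|"
      by (rule ordLeq_transitive[OF card_of_mono1 card_of_image])
    also have "|Func ?I (UNIV :: nat set) \<times> (UNIV :: nat set)| \<le>o ctwo ^c lam"
    proof (rule card_of_Times_ordLeq_infinite_Field)
      show "|UNIV :: nat set| \<le>o ctwo ^c lam"
        by (rule ordIso_ordLeq_trans[OF card_of_nat natLeq_ordLeq_cinfinite[OF inf]])
    qed (use inf nat_functions_ordLeq[OF lam] in \<open>auto simp: cinfinite_def\<close>)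
    finally show ?thesis .
  qed
  then have small: "|A| <o cardSuc (ctwo ^c lam)"
    using inf by (simp add: cardSuc_ordLeq_ordLess card_of_Card_order)
  \<comment> \<open>\<open>E g\<close> is given by representatives, so the theorem of Los applies once \<open>b\<close> is so given too\<close>
  have instance_iff: "sat ?U (override_on (E g) b X) \<psi> \<longleftrightarrow>
      mostly ?I D (\<lambda>t. sat M (override_on (a (f t) (g t)) (\<beta> t) X) \<psi>)"
    if "is_formula L \<psi>" "\<And>t. t \<in> ?I \<Longrightarrow> \<beta> t ` X \<subseteq> univ M"
      "\<And>v. v \<in> X \<Longrightarrow> b v = cls ?I D M (\<lambda>t\<in>?I. \<beta> t v)" for g b \<beta> \<psi>
  proof -
    define G where "G v = (if v \<in> X then (\<lambda>t\<in>?I. \<beta> t v) else (\<lambda>t\<in>?I. a (f t) (g t) v))" for v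
    have "G v \<in> (?I \<rightarrow>\<^sub>E univ M)" for v
      using that(2) member by (auto simp: G_def)
    moreover have "override_on (E g) b X = (\<lambda>v. cls ?I D M (G v))"
      using that(3) by (auto simp: fun_eq_iff override_on_def G_def E_def)
    moreover have "(\<lambda>v. G v t) = override_on (a (f t) (g t)) (\<beta> t) X" if "t \<in> ?I" for t
      using that by (auto simp: G_def override_on_def fun_eq_iff)
    then have "mostly ?I D (\<lambda>t. sat M (\<lambda>v. G v t) \<psi>) \<longleftrightarrow>
        mostly ?I D (\<lambda>t. sat M (override_on (a (f t) (g t)) (\<beta> t) X) \<psi>)"
      by (intro mostly_cong) (simp only:)
    ultimately show ?thesis using los[OF U M _ that(1), of G] by (simp only:)
  qed
  define nonstd where "nonstd g \<longleftrightarrow>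
    (\<forall>k. mostly ?I D (\<lambda>t. k \<le> g t)) \<and> mostly ?I D (\<lambda>t. g t < f t)" for g
  define p where "p = range (\<lambda>k. (Neg \<phi>, E (\<lambda>_. k))) \<union> (\<lambda>g. (\<phi>, E g)) ` Collect nonstd"
  have "p \<subseteq> formulas_over L X A"
    using \<phi> by (auto simp: p_def formulas_over_def A_def)
  moreover have "consistent_in ?U X p"
    unfolding consistent_in_def
  proof (intro allI impI)
    fix q assume q: "q \<subseteq> p" "finite q"
    then have "\<forall>x\<in>q. \<exists>k g. x = (Neg \<phi>, E (\<lambda>_. k)) \<or> x = (\<phi>, E g) \<and> nonstd g"
      by (auto simp: p_def)
    then obtain k g where kg:
      "\<And>x. x \<in> q \<Longrightarrow> x = (Neg \<phi>, E (\<lambda>_. k x)) \<or> x = (\<phi>, E (g x)) \<and> nonstd (g x)"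
      by metis
    obtain K where K: "\<And>x. x \<in> q \<Longrightarrow> k x < K"
      using q(2) finite_nat_set_iff_bounded[of "k ` q"] by auto
    have "\<forall>t. \<exists>b. b ` X \<subseteq> univ M \<and>
        (K \<le> f t \<longrightarrow> (\<forall>i<f t. sat M (override_on (a (f t) i) b X) \<phi> \<longleftrightarrow> K \<le> i))"
    proof
      fix t
      show "\<exists>b. b ` X \<subseteq> univ M \<and>
        (K \<le> f t \<longrightarrow> (\<forall>i<f t. sat M (override_on (a (f t) i) b X) \<phi> \<longleftrightarrow> K \<le> i))"
        using cut[of K "f t"] cut[of 0 "f t"] by (cases "K \<le> f t") auto
    qed
    then obtain \<beta> where \<beta>: "\<And>t. \<beta> t ` X \<subseteq> univ M"
      "\<And>t i. K \<le> f t \<Longrightarrow> i < f t \<Longrightarrow> sat M (override_on (a (f t) i) (\<beta> t) X) \<phi> \<longleftrightarrow> K \<le> i"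
      by metis
    define b where "b v = cls ?I D M (\<lambda>t\<in>?I. \<beta> t v)" for v
    have "sat ?U (override_on (snd x) b X) (fst x)" if x: "x \<in> q" for x
      using kg[OF x]
    proof
      assume eq: "x = (Neg \<phi>, E (\<lambda>_. k x))"
      have "mostly ?I D (\<lambda>t. sat M (override_on (a (f t) (k x)) (\<beta> t) X) (Neg \<phi>))"
        by (rule mostly_mono[OF U f[of K]]) (use K[OF x] \<beta>(2) in auto)
      then have "sat ?U (override_on (E (\<lambda>_. k x)) b X) (Neg \<phi>)"
        using instance_iff[of "Neg \<phi>" \<beta> b "\<lambda>_. k x", OF _ \<beta>(1) b_def] \<phi> by simp
      then show ?thesis using eq by (metis fst_conv snd_conv)
    next
      assume eq: "x = (\<phi>, E (g x)) \<and> nonstd (g x)"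
      then have "mostly ?I D (\<lambda>t. K \<le> f t \<and> K \<le> g x t \<and> g x t < f t)"
        using f by (simp add: nonstd_def mostly_conj[OF U])
      then have "mostly ?I D (\<lambda>t. sat M (override_on (a (f t) (g x t)) (\<beta> t) X) \<phi>)"
        by (rule mostly_mono[OF U]) (use \<beta>(2) in auto)
      then have "sat ?U (override_on (E (g x)) b X) \<phi>"
        using instance_iff[of \<phi> \<beta> b "g x", OF \<phi> \<beta>(1) b_def] by simp
      then show ?thesis using eq by (metis fst_conv snd_conv)
    qed
    moreover have "b ` X \<subseteq> univ ?U"
    proof (rule image_subsetI)
      fix v assume "v \<in> X"
      then have "(\<lambda>t\<in>?I. \<beta> t v) \<in> (?I \<rightarrow>\<^sub>E univ M)" using \<beta>(1) by auto
      then show "b v \<in> univ ?U" unfolding b_def univ_ultrapower by (rule imageI)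
    qed
    ultimately show "realized ?U X q"
      unfolding realized_def by (intro exI[of _ b]) (auto simp: case_prod_beta)
  qed
  moreover have "univ ?U \<noteq> {}" using A by (auto simp: A_def)
  ultimately have "realized ?U X p"
    using saturated_realizes_finite_tuple_types[OF saturated Cinfinite_cardSuc[OF inf] _ A small X]
    by blast
  then obtain b where b: "b ` X \<subseteq> univ ?U"
    "\<And>\<psi> e. (\<psi>, e) \<in> p \<Longrightarrow> sat ?U (override_on e b X) \<psi>"
    unfolding realized_def by fastforce
  then have "\<forall>v\<in>X. \<exists>r\<in>(?I \<rightarrow>\<^sub>E univ M). b v = cls ?I D M r"
    unfolding univ_ultrapower by blast
  then obtain r where r: "\<And>v. v \<in> X \<Longrightarrow> r v \<in> (?I \<rightarrow>\<^sub>E univ M)"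
    "\<And>v. v \<in> X \<Longrightarrow> b v = cls ?I D M (r v)"
    by metis
  define P where "P t i \<longleftrightarrow> sat M (override_on (a (f t) i) (\<lambda>v. r v t) X) \<phi>" for t i
  have iff: "sat ?U (override_on (E g) b X) \<phi> \<longleftrightarrow> mostly ?I D (\<lambda>t. P t (g t))" for g
    unfolding P_def
  proof (rule instance_iff[OF \<phi>])
    show "(\<lambda>v. r v t) ` X \<subseteq> univ M" if "t \<in> ?I" for t
      using PiE_mem[OF r(1) that] by auto
    show "b v = cls ?I D M (\<lambda>t\<in>?I. r v t)" if "v \<in> X" for v
    proof -
      have "(\<lambda>t\<in>?I. r v t) = r v" using r(1)[OF that] by auto
      then show ?thesis using r(2)[OF that] by simp
    qed
  qed
  have standard: "mostly ?I D (\<lambda>t. \<not> P t k)" for k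
  proof -
    have "sat ?U (override_on (E (\<lambda>_. k)) b X) (Neg \<phi>)" by (rule b(2)) (auto simp: p_def)
    then show ?thesis using iff[of "\<lambda>_. k"] by (simp add: mostly_not[OF U])
  qed
  have nonstandard: "mostly ?I D (\<lambda>t. P t (g t))" if "nonstd g" for g
    using b(2)[of \<phi> "E g"] that iff by (auto simp: p_def)
  \<comment> \<open>the second disjunct bounds the search by the last member of the sequence at \<open>t\<close>\<close>
  define h where "h t = (LEAST i. P t i \<or> f t \<le> Suc i)" for t
  have h_least: "P t (h t) \<or> f t \<le> Suc (h t)" "\<And>i. i < h t \<Longrightarrow> \<not> P t i" "h t \<le> f t - 1" for t
  proof -
    have last: "P t (f t - 1) \<or> f t \<le> Suc (f t - 1)" by linarith
    show "P t (h t) \<or> f t \<le> Suc (h t)" unfolding h_def by (rule LeastI) (rule last)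
    show "\<not> P t i" if "i < h t" for i using not_less_Least that unfolding h_def by blast
    show "h t \<le> f t - 1" unfolding h_def by (rule Least_le) (rule last)
  qed
  have h: "mostly ?I D (\<lambda>t. k \<le> h t)" for k
  proof -
    have "mostly ?I D (\<lambda>t. \<forall>i\<in>{..<k}. \<not> P t i)"
      by (rule mostly_ball_finite[OF U]) (use standard in auto)
    then have "mostly ?I D (\<lambda>t. (\<forall>i\<in>{..<k}. \<not> P t i) \<and> Suc k \<le> f t)"
      using f[of "Suc k"] by (simp only: mostly_conj[OF U] simp_thms)
    then show ?thesis
    proof (rule mostly_mono[OF U])
      fix t assume t: "(\<forall>i\<in>{..<k}. \<not> P t i) \<and> Suc k \<le> f t"
      show "k \<le> h t"
      proof (rule ccontr)
        assume "\<not> k \<le> h t"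
        then show False using t h_least(1)[of t] by auto
      qed
    qed
  qed
  have "nonstd (\<lambda>t. h t - 1)"
    unfolding nonstd_def
  proof (intro conjI allI)
    show "mostly ?I D (\<lambda>t. k \<le> h t - 1)" for k
      by (rule mostly_mono[OF U h[of "Suc k"]]) simp
    show "mostly ?I D (\<lambda>t. h t - 1 < f t)"
    proof (rule mostly_mono[OF U f[of 1]])
      fix t assume "1 \<le> f t"
      then show "h t - 1 < f t" using h_least(3)[of t] by simp
    qed
  qed
  then have "mostly ?I D (\<lambda>t. P t (h t - 1))" by (rule nonstandard)
  then have "mostly ?I D (\<lambda>t. P t (h t - 1) \<and> 1 \<le> h t)"
    using h[of 1] by (simp only: mostly_conj[OF U] simp_thms)
  then obtain t where "P t (h t - 1)" "1 \<le> h t" using mostly_ex[OF U] by blast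
  then show False using h_least(2)[of "h t - 1" t] by simp
qed

theorem corollary5p3:
  fixes lam :: "'i rel" and D :: "'i set set"
    and L :: "('f, 'r) language" and T :: "('f, 'r) fo_formula set"
    and M :: "('f, 'r, 'a) fo_structure"
  assumes "Card_order lam" and "cinfinite lam"
    and "regular_ultrafilter lam D"
    and "countable_language L" and "complete_theory L T"
    and "unstable TYPE('u) L T"
    and "is_model L M T"
  shows "\<not> saturated (cardSuc (ctwo ^c lam)) L (ultrapower (Field lam) D M)"
proof -
  obtain N :: "('f, 'r, 'u) fo_structure" and \<phi> X where N: "is_model L N T"
    and \<phi>: "is_formula L \<phi>" "finite X" "order_property N \<phi> X"
    using assms(6) unfolding unstable_def by blast
  obtain f :: "'i \<Rightarrow> nat" where f: "\<And>k. mostly (Field lam) D (\<lambda>t. k \<le> f t)"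
    using regular_ultrafilter_nonstandard_nat[OF _ assms(3)] assms(2)
    by (auto simp: cinfinite_def)
  show ?thesis
  proof (rule ultrapower_not_saturated[OF _ _ f _ \<phi>(1,2)])
    show "Cinfinite lam" using assms(1,2) by simp
    show "ultrafilter_on (Field lam) D" using assms(3) by (simp add: regular_ultrafilter_def)
    show "is_structure L M" using assms(7) by (simp add: is_model_def)
  qed (rule order_property_cut_sequences[OF assms(5) N assms(7) \<phi>])
qed

end
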